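(* Let $p$ be a prime number and let $M$ and $N$ be two non-empty subsets of $\mathbb{Z}/p\mathbb{Z}$. Let $L=\{x\in\mathbb{Z}/p\mathbb{Z}\mid x=a+b\text{ for some }a\in M,\ b\in N,\ a\neq b\}$. Then $|L|\geq\min(p,\,|M|+|N|-3)$.
   Context: $|\cdot|$ denotes cardinality; the inequality is between integers. *)

theory Defs
  imports "HOL-Number_Theory.Residues"
begin

definition restricted_sumset :: "('a, 'm) ring_scheme \<Rightarrow> 'a set \<Rightarrow> 'a set \<Rightarrow> 'a set" where
  "restricted_sumset R M N =
     {x \<in> carrier R. \<exists>a\<in>M. \<exists>b\<in>N. a \<noteq> b \<and> x = a \<oplus>\<^bsub>R\<^esub> b}"

end

theory Submission
  imports Defs "HOL-Computational_Algebra.Polynomial"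
begin

text \<open>
  The polynomial method of Alon, Nathanson and Ruzsa. A set \<open>A\<close> of \<open>i + 1\<close> residues carries weights
  (the divided differences) for which the weighted sum of \<open>x ^ u\<close> over \<open>A\<close> is \<open>0\<close> for \<open>u < i\<close> and
  \<open>1\<close> for \<open>u = i\<close>. If \<open>B\<close> has \<open>j + 1\<close> elements, the product weights on \<open>A \<times> B\<close> therefore extract the
  coefficient of \<open>x ^ i * y ^ j\<close> from every polynomial of total degree at most \<open>i + j\<close>.
  If the restricted sumset \<open>C\<close> had fewer than \<open>i + j\<close> elements, a monic polynomial \<open>q\<close> of degree
  \<open>i + j - 1\<close> would vanish on it, so \<open>(x - y) * q (x + y)\<close> would vanish on \<open>A \<times> B\<close>; but its
  coefficient at \<open>x ^ i * y ^ j\<close> is \<open>(i - j) * (i + j - 1)! / (i! * j!)\<close>, which is nonzero modulo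
  \<open>p\<close> if \<open>i < j\<close> and \<open>i + j \<le> p\<close>. The case of equal sizes costs one further element.
\<close>

text \<open>Induction on the nodes. When \<open>z\<close> joins \<open>B\<close>, the new functional
  applies the old one to \<open>(x ^ i - z ^ i) / (x - z)\<close>, which has degree
  \<open>i - 1\<close> in \<open>x\<close> and leading coefficient 1 for
  \<open>i > 0\<close>.\<close>

lemma ex_divided_difference_weights_mod_prime:
  fixes p :: nat and A :: "int set"
  assumes p: "prime p" and "finite A" and "A \<subseteq> {0..<int p}" and "card A = Suc n"
  shows "\<exists>w. \<forall>i\<le>n. [(\<Sum>x\<in>A. w x * x ^ i) = of_bool (i = n)] (mod int p)"
  using assms(2-4)
proof (induction n arbitrary: A)
  case 0
  then obtain a where "A = {a}" by (auto simp: card_1_singleton_iff)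
  then show ?case by (intro exI[of _ "\<lambda>_. 1"]) auto
next
  case (Suc n)
  obtain z B where A: "A = insert z B" and z: "z \<notin> B" and B: "card B = Suc n"
    using Suc.prems(3) by (metis card_Suc_eq)
  have finB: "finite B" using Suc.prems(1) A by simp
  obtain w where w: "\<And>i. i \<le> n \<Longrightarrow> [(\<Sum>x\<in>B. w x * x ^ i) = of_bool (i = n)] (mod int p)"
    using Suc.IH[OF finB _ B] Suc.prems(2) A by auto
  have "\<exists>v. [(x - z) * v = 1] (mod int p)" if "x \<in> B" for x
  proof -
    have "\<not> int p dvd x - z"
    proof
      assume "int p dvd x - z"
      then have "x mod int p = z mod int p" by (simp add: mod_eq_dvd_iff)
      then show False using Suc.prems(2) A z that by auto
    qed
    then have "coprime (x - z) (int p)"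
      using p by (simp add: prime_imp_coprime coprime_commute)
    then show ?thesis using cong_solve_coprime_int by blast
  qed
  then obtain v where v: "\<And>x. x \<in> B \<Longrightarrow> [(x - z) * v x = 1] (mod int p)" by metis
  \<comment> \<open>\<open>v x\<close> inverts \<open>x - z\<close> modulo \<open>p\<close>; the
    weight at \<open>z\<close> makes the total weight vanish.\<close>
  define w' where "w' x = (if x = z then - (\<Sum>y\<in>B. w y * v y) else w x * v x)" for x
  have "[(\<Sum>x\<in>A. w' x * x ^ i) = of_bool (i = Suc n)] (mod int p)" if i: "i \<le> Suc n" for i
  proof -
    have "(\<Sum>x\<in>A. w' x * x ^ i) = w' z * z ^ i + (\<Sum>x\<in>B. w' x * x ^ i)"
      using A z finB by simp
    also have "(\<Sum>x\<in>B. w' x * x ^ i) = (\<Sum>x\<in>B. w x * v x * x ^ i)"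
      using z by (intro sum.cong) (auto simp: w'_def)
    also have "w' z * z ^ i + \<dots> = (\<Sum>x\<in>B. w x * v x * (x ^ i - z ^ i))"
      by (simp add: w'_def sum_distrib_right sum_subtractf right_diff_distrib)
    also have "\<dots> = (\<Sum>x\<in>B. ((x - z) * v x) * (w x * (\<Sum>j<i. z ^ (i - Suc j) * x ^ j)))"
      by (intro sum.cong) (auto simp: power_diff_sumr2 mult_ac)
    also have "[\<dots> = (\<Sum>x\<in>B. 1 * (w x * (\<Sum>j<i. z ^ (i - Suc j) * x ^ j)))] (mod int p)"
      using v by (intro cong_sum cong_mult) auto
    also have "(\<Sum>x\<in>B. 1 * (w x * (\<Sum>j<i. z ^ (i - Suc j) * x ^ j)))
        = (\<Sum>j<i. z ^ (i - Suc j) * (\<Sum>x\<in>B. w x * x ^ j))"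
      by (simp add: sum_distrib_left mult_ac) (rule sum.swap)
    \<comment> \<open>Only exponents \<open>j < i\<close>, hence \<open>j \<le> n\<close>, occur, so
      the induction hypothesis covers all of them; \<open>j = n\<close> occurs only for
      \<open>i = Suc n\<close>.\<close>
    also have "[\<dots> = (\<Sum>j<i. z ^ (i - Suc j) * of_bool (j = n))] (mod int p)"
      using i by (intro cong_sum cong_mult w) auto
    also have "(\<Sum>j<i. z ^ (i - Suc j) * of_bool (j = n)) = of_bool (i = Suc n)"
      using i by (auto simp: of_bool_def if_distrib sum.delta cong: if_cong)
    finally show ?thesis .
  qed
  then show ?case by blast
qed

text \<open>Unless \<open>(u, v) = (i, j)\<close>, one exponent is below its bound and its factor
  vanishes, so the other moment, possibly beyond its known range, does not matter.\<close>

lemma mult_moments_cong: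
  fixes \<alpha> \<beta> :: "nat \<Rightarrow> int"
  assumes \<alpha>: "\<And>u. u \<le> i \<Longrightarrow> [\<alpha> u = of_bool (u = i)] (mod m)"
    and \<beta>: "\<And>v. v \<le> j \<Longrightarrow> [\<beta> v = of_bool (v = j)] (mod m)"
    and uv: "u + v \<le> i + j"
  shows "[\<alpha> u * \<beta> v = of_bool (u = i \<and> v = j)] (mod m)"
proof -
  consider "u < i" | "v < j" | "u = i" "v = j" using uv by linarith
  then show ?thesis
  proof cases
    case 1
    then show ?thesis using cong_scalar_right[OF \<alpha>, of u "\<beta> v"] by simp
  next
    case 2
    then show ?thesis using cong_scalar_left[OF \<beta>, of v "\<alpha> u"] by simp
  next
    case 3
    then show ?thesis using cong_mult[OF \<alpha> \<beta>, of u v] by simp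
  qed
qed

text \<open>With \<open>k = i + j - 1\<close> the sum is \<open>C(k, i - 1) - C(k, i)\<close>. Times
  \<open>i! * j!\<close> it becomes \<open>(i - j) * k!\<close>, where \<open>0 < j - i < p\<close>
  and \<open>k < p\<close>.\<close>

lemma ballot_binomial_not_dvd:
  fixes p i j :: nat
  assumes p: "prime p" and ij: "i < j" "j < p" "i + j \<le> p"
  shows "\<not> int p dvd (\<Sum>r\<le>i + j - 1. int ((i + j - 1) choose r) *
      (of_bool (Suc r = i \<and> i + j - 1 - r = j) - of_bool (r = i \<and> Suc (i + j - 1 - r) = j)))"
    (is "\<not> _ dvd ?D")
proof
  define k where "k = i + j - 1"
  have j: "Suc (k - i) = j" "i \<le> k" using ij by (auto simp: k_def)
  assume dvd: "int p dvd ?D"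
  \<comment> \<open>The first part stays a sum: for \<open>i = 0\<close> it is 0, whereas
    \<open>k choose (i - 1)\<close> would be 1.\<close>
  have "?D = (\<Sum>r\<le>k. (if Suc r = i then int (k choose r) else 0)) -
      (\<Sum>r\<le>k. (if r = i then int (k choose r) else 0))"
    unfolding k_def[symmetric] sum_subtractf[symmetric]
    using ij by (intro sum.cong) (auto simp: k_def)
  also have "(\<Sum>r\<le>k. (if r = i then int (k choose r) else 0)) = int (k choose i)"
    using j by simp
  finally have D: "?D = (\<Sum>r\<le>k. (if Suc r = i then int (k choose r) else 0)) - int (k choose i)" .
  have 1: "int (fact i * fact j) * int (k choose i) = int j * fact k"
  proof -
    have "fact j = j * fact (k - i)" using j by (metis fact_Suc of_nat_id)
    then have "fact i * fact j * (k choose i) = j * fact k"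
      using binomial_fact_lemma[OF j(2)] by (metis mult.assoc mult.commute)
    then show ?thesis by (metis of_nat_fact of_nat_mult)
  qed
  have 2: "int (fact i * fact j) * (\<Sum>r\<le>k. (if Suc r = i then int (k choose r) else 0))
      = int i * fact k"
  proof (cases i)
    case (Suc l)
    have l: "l \<le> k" "k - l = j" using Suc ij by (auto simp: k_def)
    have "fact i * fact j * (k choose l) = i * fact k"
      using binomial_fact_lemma[OF l(1)] l(2) Suc by (metis fact_Suc mult.assoc of_nat_id)
    moreover have "(\<Sum>r\<le>k. (if Suc r = i then int (k choose r) else 0)) = int (k choose l)"
      using l Suc by simp
    ultimately show ?thesis by (metis of_nat_fact of_nat_mult)
  qed simp
  have "?D * int (fact i * fact j) = (int i - int j) * fact k"
    by (subst D, subst mult.commute) (simp only: right_diff_distrib 1 2 left_diff_distrib)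
  then have "int p dvd (int i - int j) * fact k"
    by (rule subst) (rule dvd_mult2[OF dvd])
  then have "int p dvd int i - int j \<or> int p dvd int (fact k)"
    using p by (simp add: prime_dvd_mult_iff)
  then show False
  proof
    assume "int p dvd int i - int j"
    then have "int p dvd int (j - i)" using ij by (simp add: of_nat_diff dvd_diff_commute)
    then have "p \<le> j - i" using ij by (simp only: int_dvd_int_iff) (simp add: dvd_imp_le)
    then show False using ij by simp
  next
    assume "int p dvd int (fact k)"
    then have "p \<le> k" using p by (simp only: int_dvd_int_iff prime_dvd_fact_iff)
    then show False using ij by (auto simp: k_def)
  qed
qed

text \<open>\<open>C\<close> need only contain the sums, so \<open>A\<close> and \<open>B\<close>
  may be shrunk while the full restricted sumset is kept.\<close>

lemma card_restricted_sums_ge: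
  fixes p i j :: nat and A B C :: "int set"
  assumes p: "prime p" and A: "A \<subseteq> {0..<int p}" "card A = Suc i"
    and B: "B \<subseteq> {0..<int p}" "card B = Suc j"
    and ij: "i < j" "i + j \<le> p" and "finite C"
    and C: "\<And>x y. x \<in> A \<Longrightarrow> y \<in> B \<Longrightarrow> x \<noteq> y \<Longrightarrow> (x + y) mod int p \<in> C"
  shows "i + j \<le> card C"
proof (rule ccontr)
  assume less: "\<not> i + j \<le> card C"
  define k where "k = i + j - 1"
  have k: "card C \<le> k" "Suc k = i + j" using less ij by (auto simp: k_def)
  have fin: "finite A" "finite B" using A B by (auto intro: card_ge_0_finite)
  \<comment> \<open>This excludes \<open>i = 0\<close>, \<open>j = p\<close>, where
    \<open>i - j\<close> vanishes modulo \<open>p\<close>.\<close>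
  have "j < p" using card_mono[OF _ B(1)] B(2) by simp
  obtain f where f: "\<And>u. u \<le> i \<Longrightarrow> [(\<Sum>x\<in>A. f x * x ^ u) = of_bool (u = i)] (mod int p)"
    using ex_divided_difference_weights_mod_prime[OF p fin(1) A] by blast
  obtain g where g: "\<And>v. v \<le> j \<Longrightarrow> [(\<Sum>y\<in>B. g y * y ^ v) = of_bool (v = j)] (mod int p)"
    using ex_divided_difference_weights_mod_prime[OF p fin(2) B] by blast
  define \<Phi> where "\<Phi> F = (\<Sum>x\<in>A. \<Sum>y\<in>B. f x * g y * F x y)" for F :: "int \<Rightarrow> int \<Rightarrow> int"
  have \<Phi>_sum: "\<Phi> (\<lambda>x y. \<Sum>r\<in>I. F r x y) = (\<Sum>r\<in>I. \<Phi> (F r))" for I :: "nat set" and F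
  proof -
    have "\<Phi> (\<lambda>x y. \<Sum>r\<in>I. F r x y) = (\<Sum>x\<in>A. \<Sum>r\<in>I. \<Sum>y\<in>B. f x * g y * F r x y)"
      unfolding \<Phi>_def sum_distrib_left by (intro sum.cong refl sum.swap)
    also have "\<dots> = (\<Sum>r\<in>I. \<Phi> (F r))"
      unfolding \<Phi>_def by (rule sum.swap)
    finally show ?thesis .
  qed
  have \<Phi>_scale: "\<Phi> (\<lambda>x y. c * F x y) = c * \<Phi> F" for c F
    unfolding \<Phi>_def sum_distrib_left by (simp add: mult_ac)
  have \<Phi>_diff: "\<Phi> (\<lambda>x y. F x y - G x y) = \<Phi> F - \<Phi> G" for F G
    by (simp add: \<Phi>_def right_diff_distrib sum_subtractf)
  have \<Phi>_monom: "[\<Phi> (\<lambda>x y. x ^ u * y ^ v) = of_bool (u = i \<and> v = j)] (mod int p)"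
    if "u + v \<le> i + j" for u v
  proof -
    have "\<Phi> (\<lambda>x y. x ^ u * y ^ v) = (\<Sum>x\<in>A. f x * x ^ u) * (\<Sum>y\<in>B. g y * y ^ v)"
      unfolding \<Phi>_def sum_product by (simp add: mult_ac)
    then show ?thesis
      using mult_moments_cong[of i "\<lambda>u. \<Sum>x\<in>A. f x * x ^ u" _ j "\<lambda>v. \<Sum>y\<in>B. g y * y ^ v", OF f g that]
      by simp
  qed
  \<comment> \<open>The part of the coefficient of \<open>x ^ i * y ^ j\<close> in
    \<open>(x - y) * (x + y) ^ l\<close> that comes from the \<open>r\<close>-th binomial
    term.\<close>
  define c where "c l r = int (l choose r) *
    (of_bool (Suc r = i \<and> l - r = j) - of_bool (r = i \<and> Suc (l - r) = j))" for l r
  have \<Phi>_power: "[\<Phi> (\<lambda>x y. (x - y) * (x + y) ^ l) = (\<Sum>r\<le>l. c l r)] (mod int p)"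
    if "l \<le> k" for l
  proof -
    have "(x - y) * (x + y) ^ l = (\<Sum>r\<le>l. int (l choose r) *
        (x ^ Suc r * y ^ (l - r) - x ^ r * y ^ Suc (l - r)))" for x y :: int
      unfolding binomial_ring sum_distrib_left by (intro sum.cong) (auto simp: algebra_simps)
    then have "\<Phi> (\<lambda>x y. (x - y) * (x + y) ^ l) = (\<Sum>r\<le>l. int (l choose r) *
        (\<Phi> (\<lambda>x y. x ^ Suc r * y ^ (l - r)) - \<Phi> (\<lambda>x y. x ^ r * y ^ Suc (l - r))))"
      by (simp only: \<Phi>_sum \<Phi>_scale \<Phi>_diff)
    also have "[\<dots> = (\<Sum>r\<le>l. c l r)] (mod int p)"
      unfolding c_def using k that by (intro cong_sum cong_scalar_left cong_diff \<Phi>_monom) auto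
    finally show ?thesis .
  qed
  \<comment> \<open>The monomial pads the degree to exactly \<open>k\<close>, since \<open>C\<close>
    may be smaller.\<close>
  define q where "q = (\<Prod>c\<in>C. [:- c, 1:]) * monom (1::int) (k - card C)"
  have monic: "lead_coeff (\<Prod>c\<in>C. [:- c, 1::int:]) = 1"
    by (simp add: lead_coeff_prod)
  have degP: "degree (\<Prod>c\<in>C. [:- c, 1::int:]) = card C"
    by (subst degree_prod_eq_sum_degree) auto
  have deg: "degree q = k"
    unfolding q_def using monic degP k(1) by (subst degree_mult_eq) (auto simp: degree_monom_eq)
  have lead: "coeff q k = 1"
  proof -
    have "coeff q k = lead_coeff q" by (simp only: deg)
    also have "\<dots> = 1" unfolding q_def lead_coeff_mult lead_coeff_monom monic by simp
    finally show ?thesis .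
  qed
  have "int p dvd \<Phi> (\<lambda>x y. (x - y) * poly q (x + y))"
    unfolding \<Phi>_def
  proof (rule dvd_sum, rule dvd_sum, rule dvd_mult)
    fix x y assume xy: "x \<in> A" "y \<in> B"
    show "int p dvd (x - y) * poly q (x + y)"
    proof (cases "x = y")
      case False
      \<comment> \<open>The factor at \<open>c = (x + y) mod int p\<close> is a multiple of
        \<open>p\<close>.\<close>
      then have "int p dvd (\<Prod>c\<in>C. x + y - c)"
        using C[OF xy] \<open>finite C\<close> by (intro dvd_trans[OF _ dvd_prodI]) auto
      moreover have "(\<Prod>c\<in>C. x + y - c) dvd poly q (x + y)"
        by (simp add: q_def poly_prod)
      ultimately show ?thesis by (meson dvd_mult dvd_trans)
    qed simp
  qed
  moreover have "\<Phi> (\<lambda>x y. (x - y) * poly q (x + y)) =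
      (\<Sum>l\<le>k. coeff q l * \<Phi> (\<lambda>x y. (x - y) * (x + y) ^ l))"
  proof -
    have "(x - y) * poly q (x + y) = (\<Sum>l\<le>k. coeff q l * ((x - y) * (x + y) ^ l))" for x y
      by (simp add: poly_altdef deg sum_distrib_left mult.left_commute)
    then show ?thesis by (simp only: \<Phi>_sum \<Phi>_scale)
  qed
  moreover have "[(\<Sum>l\<le>k. coeff q l * \<Phi> (\<lambda>x y. (x - y) * (x + y) ^ l)) =
      (\<Sum>l\<le>k. coeff q l * (\<Sum>r\<le>l. c l r))] (mod int p)"
    by (intro cong_sum cong_scalar_left \<Phi>_power) auto
  moreover have "(\<Sum>l\<le>k. coeff q l * (\<Sum>r\<le>l. c l r)) = (\<Sum>r\<le>k. c k r)"
  proof -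
    \<comment> \<open>Here \<open>(x - y) * (x + y) ^ l\<close> is homogeneous of degree
      \<open>l + 1 < i + j\<close>.\<close>
    have "(\<Sum>r\<le>l. c l r) = 0" if "l < k" for l
      using that k ij by (intro sum.neutral) (auto simp: c_def)
    then have "(\<Sum>l\<le>k. coeff q l * (\<Sum>r\<le>l. c l r)) = (\<Sum>l\<le>k. if l = k then \<Sum>r\<le>k. c k r else 0)"
      using lead by (intro sum.cong) auto
    then show ?thesis by simp
  qed
  ultimately have "int p dvd (\<Sum>r\<le>k. c k r)"
    by (metis cong_dvd_iff)
  then show False
    using ballot_binomial_not_dvd[OF p ij(1) \<open>j < p\<close> ij(2)] by (simp add: c_def k_def)
qed

text \<open>The smaller set \<open>M\<close> gives up an element to make the sizes differ; a
  singleton cannot, so then \<open>N\<close> does.\<close>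

lemma ex_subset_cards_unequal:
  fixes M N :: "'a set" and p :: nat
  assumes "card M \<le> card N" "card N \<le> p" "0 < card M" "3 < card M + card N"
  obtains A B i j where "A \<subseteq> M" "B \<subseteq> N" "card A = Suc i" "card B = Suc j" "i < j"
    "i + j = min p (card M + card N - 3)"
proof (cases "card M = 1")
  case True
  obtain B where "B \<subseteq> N" "card B = card N - 1"
    by (meson diff_le_self obtain_subset_with_card_n)
  then show ?thesis using assms True by (intro that[of M B 0 "card N - 2"]) auto
next
  case False
  \<comment> \<open>The first bound caps \<open>i + j = a + card N - 2\<close> at \<open>p\<close>,
    the second forces \<open>a < card N\<close>.\<close>
  define a where "a = min (p + 2 - card N) (card M - 1)"
  obtain A where "A \<subseteq> M" "card A = a"
    by (rule obtain_subset_with_card_n[of a M]) (auto simp: a_def)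
  then show ?thesis using assms False
    by (intro that[of A N "a - 1" "card N - 1"]) (auto simp: a_def min_def)
qed

lemma restricted_sumset_commute:
  "restricted_sumset (residue_ring m) M N = restricted_sumset (residue_ring m) N M"
  by (auto simp: restricted_sumset_def residue_ring_def add.commute; metis add.commute)

lemma card_restricted_sumset_ge:
  fixes p :: nat and M N :: "int set"
  assumes p: "prime p" and M: "M \<subseteq> {0..<int p}" "M \<noteq> {}" and N: "N \<subseteq> {0..<int p}"
    and le: "card M \<le> card N"
  shows "min p (card M + card N - 3) \<le> card (restricted_sumset (residue_ring (int p)) M N)"
\<comment> \<open>For total size at most 3, truncated subtraction makes the bound 0.\<close>
proof (cases "3 < card M + card N")
  case True
  have "card N \<le> p" using card_mono[OF _ N] by simp
  moreover have "0 < card M" using M by (auto simp: card_gt_0_iff intro: finite_subset)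
  ultimately obtain A B i j where AB: "A \<subseteq> M" "B \<subseteq> N" "card A = Suc i" "card B = Suc j" "i < j"
    and ij: "i + j = min p (card M + card N - 3)"
    using ex_subset_cards_unequal[OF le _ _ True] by metis
  have "p > 0" using p by (rule prime_gt_0_nat)
  have "i + j \<le> card (restricted_sumset (residue_ring (int p)) M N)"
  proof (rule card_restricted_sums_ge[OF p _ AB(3) _ AB(4,5)])
    show "(x + y) mod int p \<in> restricted_sumset (residue_ring (int p)) M N"
      if "x \<in> A" "y \<in> B" "x \<noteq> y" for x y
      using that AB \<open>p > 0\<close> by (auto simp: restricted_sumset_def residue_ring_def)
    show "finite (restricted_sumset (residue_ring (int p)) M N)"
      by (rule finite_subset[of _ "{0..int p - 1}"]) (auto simp: restricted_sumset_def residue_ring_def)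
  qed (use M N AB ij in auto)
  then show ?thesis using ij by simp
qed simp

theorem theorem5p3:
  fixes p :: nat and M N :: "int set"
  assumes "prime p"
    and "M \<subseteq> carrier (residue_ring (int p))" and "M \<noteq> {}"
    and "N \<subseteq> carrier (residue_ring (int p))" and "N \<noteq> {}"
  shows "int (card (restricted_sumset (residue_ring (int p)) M N))
           \<ge> min (int p) (int (card M) + int (card N) - 3)"
proof -
  have "carrier (residue_ring (int p)) = {0..<int p}"
    by (auto simp: residue_ring_def)
  then have "min p (card M + card N - 3) \<le> card (restricted_sumset (residue_ring (int p)) M N)"
    using card_restricted_sumset_ge[of p M N] card_restricted_sumset_ge[of p N M] assms
      restricted_sumset_commute[of "int p" M N]
    by (cases "card M \<le> card N") (auto simp: add.commute)
  \<comment> \<open>The integer bound is -1 for two singletons; the truncated one is never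
    smaller.\<close>
  then show ?thesis by linarith
qed

end
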